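(* Let $X$ be a Banach space and let $T\in C(X)$ have an $\mathfrak{L}$-hyperbolic point $x^\ast$. Then $x^\ast$ is isolated; that is, there exists a neighborhood $U$ of $x^\ast$ in $X$ such that the constant solution $\xi\equiv x^\ast$ is the only global solution $\xi$ of $T$ with $\xi(\mathbb{Z})\subset U$.
   Context: $C(X)$ is the set of continuous maps $X\to X$. An equilibrium point of $T$ is $x^\ast$ with $T(x^\ast)=x^\ast$. A global solution of $T$ is a function $\xi\colon\mathbb Z\to X$ with $T(\xi(m))=\xi(m+1)$ for all $m\in\mathbb Z$. A map is bi-Lipschitz if it is invertible and it and its inverse are Lipschitz. Weakly hyperbolic points. Let $L$ be a bounded linear operator on $X$ with $\sigma(L)\cap\{|\lambda|=1\}=\varnothing$. Put $\pi_s=\frac1{2\pi i}\int_{|\lambda|=1}(\lambda-L)^{-1}d\lambda$, $\pi_u=I-\pi_s$, $X_j=\pi_jX$, $L_j=L|_{X_j}$ ($j=u,s$). One has $0<b<1<a$ with $\sigma(L_s)\subset\{|\lambda|<b\}$, $\sigma(L_u)\subset\{|\lambda|>a\}$, and $X$ is equipped with an equivalent norm satisfying $\|L_s\|\leqslant b$, $\|L_u^{-1}\|\leqslant a^{-1}$, $\|x_u+x_s\|=\max\{\|x_u\|,\|x_s\|\}$. An equilibrium point $x^\ast$ of $T$ is weakly hyperbolic if $S(x)=T(x+x^\ast)-x^\ast$ has a decomposition $S=L+N$ with: (i) $L,a,b$ and the norm as just described; (ii) there are a neighborhood $U_0$ of $0$ and $\gamma={\rm Lip}(N)>0$ with $b+2\gamma<1<a-2\gamma$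 and $\|N(x)-N(y)\|\leqslant\gamma\|x-y\|$ on $U_0$; (iii) $0<\gamma\|(I-L)^{-1}\|\leqslant1$. Local manifolds. For a weakly hyperbolic point $x^\ast$ of $T$, $W^{\rm s}_{loc}(x^\ast)$ and $W^{\rm u}_{loc}(x^\ast)$ denote the local stable and unstable manifolds: for suitable $\epsilon_0>0$ and neighborhoods $U$ of $x^\ast$ and $V_u,V_s$ of $0$ in $X_u,X_s$, they are graphs of Lipschitz maps over $x^\ast+V_s$ and $x^\ast+V_u$ respectively, and $W^{\rm s}_{loc}(x^\ast)=\{x\in U: T^nx\in U\ \forall n\geqslant0,\ \|T^nx-x^\ast\|=o((1-\epsilon_0)^n)\}$, $W^{\rm u}_{loc}(x^\ast)=\{x\in U:\exists\{x_j\}_{j\leqslant0}\subset U,\ x_0=x,\ x_{j+1}=T(x_j),\ \sup_{j\leqslant0}(1+\epsilon_0)^{-j}\|x_j-x^\ast\|<\infty\}$. $\mathfrak L$-hyperbolic points. A weakly hyperbolic point $x^\ast$ of $T$, with decomposition $S=L+N$, is $\mathfrak L$-hyperbolic if ${\rm Lip}(N)<\gamma_1$, where $\gamma_1=\gamma_1(L)>0$ is a constant (whose existence the paper proves) with the following property: if $R\in C(X)$ has $0$ as a weakly hyperbolic point with decomposition $R=L+N$ and ${\rm Lip}(N)<\gamma_1$, then there are neighborhoods $O,V_u,V_s$ of $0$ in $X,X_u,X_s$ and a bi-Lipschitz map $g\colon X\to X$ with $g(0)=0$ such that $0$ is a weakly hyperbolic point of $R_1=g^{-1}\circ R\circ g$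 with decomposition $R_1=L+N_1$, and the local manifolds of $0$ for $R_1$ satisfy $W^{\rm u,1}_{loc}(0)\cap O=V_u$, $W^{\rm s,1}_{loc}(0)\cap O=V_s$; in particular $\pi_uN_1(x_s)=0=\pi_sN_1(x_u)$ for $x_u\in V_u$, $x_s\in V_s$. *)

theory Defs
  imports "HOL-Analysis.Analysis" "HOL-Library.Landau_Symbols"
begin

section \<open>Spectrum and spectral projections of an operator on a real Banach space\<close>

text \<open>
  The spectrum of a bounded operator on the real Banach space \<open>'a\<close> is that of its complexification,
  which acts componentwise on \<open>'a \<times> 'a\<close>, a pair \<open>(x, y)\<close> standing for \<open>x + \<i> y\<close>.  Complex Banach
  spaces are included: for a complex-linear \<open>L\<close>, passing to the underlying real space replaces the
  spectrum by its union with its complex conjugate and does not change the spectral projections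
  below.
\<close>

definition cscale :: "complex \<Rightarrow> 'a::real_vector \<times> 'a \<Rightarrow> 'a \<times> 'a" where
  "cscale c z = (Re c *\<^sub>R fst z - Im c *\<^sub>R snd z, Im c *\<^sub>R fst z + Re c *\<^sub>R snd z)"

text \<open>The complexified operator \<open>c - A\<close>:\<close>

definition cshift :: "complex \<Rightarrow> ('a::real_vector \<Rightarrow> 'a) \<Rightarrow> 'a \<times> 'a \<Rightarrow> 'a \<times> 'a" where
  "cshift c A z = cscale c z - (A (fst z), A (snd z))"

text \<open>The spectrum of the restriction of \<open>A\<close> to an invariant subspace \<open>V\<close>:\<close>

definition spectrum_on :: "'a::real_normed_vector set \<Rightarrow> ('a \<Rightarrow> 'a) \<Rightarrow> complex set" where
  "spectrum_on V A =
     {c. \<not> (bij_betw (cshift c A) (V \<times> V) (V \<times> V) \<and>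
            (\<exists>K. \<forall>z \<in> V \<times> V. norm (inv_into (V \<times> V) (cshift c A) z) \<le> K * norm z))}"

definition resolvent :: "('a::banach \<Rightarrow>\<^sub>L 'a) \<Rightarrow> complex \<Rightarrow> ('a \<times> 'a) \<Rightarrow>\<^sub>L ('a \<times> 'a)" where
  "resolvent L c = Blinfun (inv (cshift c (blinfun_apply L)))"

text \<open>
  The operator \<open>1 / (2 \<pi> \<i>) * \<integral> (c - L)\<^sup>-\<^sup>1 dc\<close> over the unit circle, parametrised by
  \<open>c = cis t\<close>, \<open>dc = \<i> * cis t dt\<close>.  The integral is that of an operator-valued function.
\<close>

definition riesz_projection :: "('a::banach \<Rightarrow>\<^sub>L 'a) \<Rightarrow> ('a \<times> 'a) \<Rightarrow>\<^sub>L ('a \<times> 'a)" where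
  "riesz_projection L =
     Blinfun (cscale (1 / (2 * of_real pi * \<i>))) o\<^sub>L
     integral {0..2 * pi} (\<lambda>t. Blinfun (cscale (\<i> * cis t)) o\<^sub>L resolvent L (cis t))"

text \<open>The circle is symmetric under conjugation, so the projection above maps real vectors to real
  vectors.\<close>

definition proj_s :: "('a::banach \<Rightarrow>\<^sub>L 'a) \<Rightarrow> 'a \<Rightarrow> 'a" where
  "proj_s L x = fst (blinfun_apply (riesz_projection L) (x, 0))"

definition proj_u :: "('a::banach \<Rightarrow>\<^sub>L 'a) \<Rightarrow> 'a \<Rightarrow> 'a" where
  "proj_u L x = x - proj_s L x"

definition space_s :: "('a::banach \<Rightarrow>\<^sub>L 'a) \<Rightarrow> 'a set" where
  "space_s L = range (proj_s L)"

definition space_u :: "('a::banach \<Rightarrow>\<^sub>L 'a) \<Rightarrow> 'a set" where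
  "space_u L = range (proj_u L)"

section \<open>Weakly hyperbolic equilibrium points\<close>

definition equivalent_norm :: "('a::real_normed_vector \<Rightarrow> real) \<Rightarrow> bool" where
  "equivalent_norm p \<longleftrightarrow>
     (\<forall>x y. p (x + y) \<le> p x + p y) \<and>
     (\<forall>c x. p (c *\<^sub>R x) = \<bar>c\<bar> * p x) \<and>
     (\<exists>k > 0. \<exists>K. \<forall>x. k * norm x \<le> p x \<and> p x \<le> K * norm x)"

text \<open>Operator norm, with respect to the norm \<open>p\<close>, of the restriction of \<open>A\<close> to the subspace \<open>V\<close>:\<close>

definition opnorm_on :: "('a::real_normed_vector \<Rightarrow> real) \<Rightarrow> 'a set \<Rightarrow> ('a \<Rightarrow> 'a) \<Rightarrow> real" where
  "opnorm_on p V A = (SUP x\<in>{x \<in> V. p x \<le> 1}. p (A x))"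

definition hyperbolic_operator ::
  "('a::banach \<Rightarrow>\<^sub>L 'a) \<Rightarrow> real \<Rightarrow> real \<Rightarrow> ('a \<Rightarrow> real) \<Rightarrow> bool" where
  "hyperbolic_operator L a b p \<longleftrightarrow>
     spectrum_on UNIV (blinfun_apply L) \<inter> {c. cmod c = 1} = {} \<and>
     0 < b \<and> b < 1 \<and> 1 < a \<and>
     spectrum_on (space_s L) (blinfun_apply L) \<subseteq> {c. cmod c < b} \<and>
     spectrum_on (space_u L) (blinfun_apply L) \<subseteq> {c. cmod c > a} \<and>
     equivalent_norm p \<and>
     opnorm_on p (space_s L) (blinfun_apply L) \<le> b \<and>
     opnorm_on p (space_u L) (inv_into (space_u L) (blinfun_apply L)) \<le> inverse a \<and>
     (\<forall>xu \<in> space_u L. \<forall>xs \<in> space_s L. p (xu + xs) = max (p xu) (p xs))"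

text \<open>
  \<open>x0\<close> is a weakly hyperbolic point of \<open>T\<close> with decomposition \<open>L + N\<close> of the translated map, where
  \<open>\<gamma>\<close> plays the role of \<open>Lip(N)\<close>: it is a positive Lipschitz constant of \<open>N\<close> near \<open>0\<close>, not
  necessarily the least one, so that \<open>N = 0\<close> is allowed.
\<close>

definition weakly_hyperbolic ::
  "('a::banach \<Rightarrow>\<^sub>L 'a) \<Rightarrow> real \<Rightarrow> real \<Rightarrow> ('a \<Rightarrow> real) \<Rightarrow> ('a \<Rightarrow> 'a) \<Rightarrow> real
     \<Rightarrow> ('a \<Rightarrow> 'a) \<Rightarrow> 'a \<Rightarrow> bool" where
  "weakly_hyperbolic L a b p N \<gamma> T x0 \<longleftrightarrow>
     T x0 = x0 \<and>
     (\<forall>x. T (x + x0) - x0 = blinfun_apply L x + N x) \<and>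
     hyperbolic_operator L a b p \<and>
     0 < \<gamma> \<and> b + 2 * \<gamma> < 1 \<and> 1 < a - 2 * \<gamma> \<and>
     (\<exists>U0. 0 \<in> interior U0 \<and> (\<forall>x \<in> U0. \<forall>y \<in> U0. p (N x - N y) \<le> \<gamma> * p (x - y))) \<and>
     0 < \<gamma> * opnorm_on p UNIV (inv (\<lambda>x. x - blinfun_apply L x)) \<and>
     \<gamma> * opnorm_on p UNIV (inv (\<lambda>x. x - blinfun_apply L x)) \<le> 1"

section \<open>Local stable and unstable manifolds\<close>

text \<open>The sets below do not depend on the choice of an equivalent norm.\<close>

definition local_stable_set ::
  "('a::real_normed_vector \<Rightarrow> 'a) \<Rightarrow> 'a \<Rightarrow> real \<Rightarrow> 'a set \<Rightarrow> 'a set" where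
  "local_stable_set T x0 \<epsilon> U =
     {x \<in> U. (\<forall>n. (T ^^ n) x \<in> U) \<and>
             (\<lambda>n. norm ((T ^^ n) x - x0)) \<in> o(\<lambda>n. (1 - \<epsilon>) ^ n)}"

definition local_unstable_set ::
  "('a::real_normed_vector \<Rightarrow> 'a) \<Rightarrow> 'a \<Rightarrow> real \<Rightarrow> 'a set \<Rightarrow> 'a set" where
  "local_unstable_set T x0 \<epsilon> U =
     {x \<in> U. \<exists>y :: int \<Rightarrow> 'a. (\<forall>j \<le> 0. y j \<in> U) \<and> y 0 = x \<and> (\<forall>j < 0. y (j + 1) = T (y j)) \<and>
             bdd_above ((\<lambda>j. (1 + \<epsilon>) powi (- j) * norm (y j - x0)) ` {..0})}"

definition neighborhood_in :: "'a::topological_space set \<Rightarrow> 'a \<Rightarrow> 'a set \<Rightarrow> bool" where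
  "neighborhood_in S x V \<longleftrightarrow> V \<subseteq> S \<and> x \<in> top_of_set S interior_of V"

definition lipschitz_graph ::
  "'a::real_normed_vector \<Rightarrow> 'a set \<Rightarrow> 'a set \<Rightarrow> 'a set \<Rightarrow> bool" where
  "lipschitz_graph x0 V Y W \<longleftrightarrow>
     (\<exists>h K. h ` V \<subseteq> Y \<and> K-lipschitz_on V h \<and> W = (\<lambda>v. x0 + v + h v) ` V)"

definition local_manifolds ::
  "('a::banach \<Rightarrow>\<^sub>L 'a) \<Rightarrow> ('a \<Rightarrow> 'a) \<Rightarrow> 'a \<Rightarrow> 'a set \<Rightarrow> 'a set \<Rightarrow> bool" where
  "local_manifolds L T x0 Wu Ws \<longleftrightarrow>
     (\<exists>\<epsilon> U Vu Vs. 0 < \<epsilon> \<and> \<epsilon> < 1 \<and> x0 \<in> interior U \<and>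
        neighborhood_in (space_u L) 0 Vu \<and> neighborhood_in (space_s L) 0 Vs \<and>
        lipschitz_graph x0 Vs (space_u L) Ws \<and> lipschitz_graph x0 Vu (space_s L) Wu \<and>
        Ws = local_stable_set T x0 \<epsilon> U \<and> Wu = local_unstable_set T x0 \<epsilon> U)"

section \<open>L-hyperbolic equilibrium points\<close>

definition bi_lipschitz :: "('a::metric_space \<Rightarrow> 'a) \<Rightarrow> bool" where
  "bi_lipschitz g \<longleftrightarrow>
     bij g \<and> (\<exists>K. K-lipschitz_on UNIV g) \<and> (\<exists>K. K-lipschitz_on UNIV (inv g))"

text \<open>
  The property of the constant \<open>\<gamma>\<^sub>1(L)\<close>: perturbations of \<open>L\<close> with Lipschitz constant below it can
  be conjugated so that the local manifolds become flat.  The rates \<open>a\<close>, \<open>b\<close> and the norm \<open>p\<close> are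
  fixed together with \<open>L\<close>.
\<close>

definition flattening_constant ::
  "('a::banach \<Rightarrow>\<^sub>L 'a) \<Rightarrow> real \<Rightarrow> real \<Rightarrow> ('a \<Rightarrow> real) \<Rightarrow> real \<Rightarrow> bool" where
  "flattening_constant L a b p \<gamma>\<^sub>1 \<longleftrightarrow>
     0 < \<gamma>\<^sub>1 \<and>
     (\<forall>R N \<gamma>. continuous_on UNIV R \<and> weakly_hyperbolic L a b p N \<gamma> R 0 \<and> \<gamma> < \<gamma>\<^sub>1 \<longrightarrow>
        (\<exists>Q Vu Vs g N\<^sub>1 \<delta> Wu Ws.
           0 \<in> interior Q \<and>
           neighborhood_in (space_u L) 0 Vu \<and> neighborhood_in (space_s L) 0 Vs \<and>
           bi_lipschitz g \<and> g 0 = 0 \<and>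
           weakly_hyperbolic L a b p N\<^sub>1 \<delta> (inv g \<circ> R \<circ> g) 0 \<and>
           local_manifolds L (inv g \<circ> R \<circ> g) 0 Wu Ws \<and>
           Wu \<inter> Q = Vu \<and> Ws \<inter> Q = Vs \<and>
           (\<forall>xs \<in> Vs. proj_u L (N\<^sub>1 xs) = 0) \<and> (\<forall>xu \<in> Vu. proj_s L (N\<^sub>1 xu) = 0)))"

definition L_hyperbolic :: "('a::banach \<Rightarrow> 'a) \<Rightarrow> 'a \<Rightarrow> bool" where
  "L_hyperbolic T x0 \<longleftrightarrow>
     (\<exists>L a b p N \<gamma> \<gamma>\<^sub>1. weakly_hyperbolic L a b p N \<gamma> T x0 \<and>
        flattening_constant L a b p \<gamma>\<^sub>1 \<and> \<gamma> < \<gamma>\<^sub>1)"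

definition global_solution :: "('a \<Rightarrow> 'a) \<Rightarrow> (int \<Rightarrow> 'a) \<Rightarrow> bool" where
  "global_solution T \<xi> \<longleftrightarrow> (\<forall>m. T (\<xi> m) = \<xi> (m + 1))"

end

theory Submission
  imports Defs
begin

text \<open>
  A solution that stays near a weakly hyperbolic point \<open>x\<^sup>*\<close> must vanish after translation because
  its stable part is controlled by the past and its unstable part by the future.  Write
  \<open>w\<^sub>m = \<xi>\<^sub>m - x\<^sup>*\<close>, so that \<open>w\<^sub>m\<^sub>+\<^sub>1 = L w\<^sub>m + N w\<^sub>m\<close> with \<open>p (N w) \<le> \<gamma> p w\<close> close to \<open>0\<close>, and
  split \<open>w\<^sub>m = u\<^sub>m + s\<^sub>m\<close> along the unstable and stable spaces.  Both spaces are invariant under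
  \<open>L\<close>, and \<open>p w = max (p u) (p s)\<close>, so with \<open>M = sup\<^sub>m p w\<^sub>m\<close>, finite on a bounded
  neighbourhood,

    \<open>p s\<^sub>m\<^sub>+\<^sub>1 \<le> b p s\<^sub>m + \<gamma> p w\<^sub>m \<le> (b + \<gamma>) M\<close> and
    \<open>a p u\<^sub>m \<le> p u\<^sub>m\<^sub>+\<^sub>1 + \<gamma> p w\<^sub>m \<le> (1 + \<gamma>) M\<close>.

  On a two-sided orbit every index is both a successor and a predecessor, hence
  \<open>M \<le> max (b + \<gamma>) ((1 + \<gamma>) / a) M\<close>.  The gap conditions \<open>b + 2\<gamma> < 1 < a - 2\<gamma>\<close> make this factor
  smaller than one, so \<open>M = 0\<close>.

  The invariance of the spaces is read off from the spectral conditions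
  (\<open>spectrum_on_invariant\<close>) without computing with the contour integral, the expansion and
  contraction rates come from \<open>hyperbolic_operator_contracts\<close> and \<open>hyperbolic_operator_expands\<close>,
  and the effect of one step on both components is \<open>hyperbolic_step\<close>.
\<close>

section \<open>Equivalent norms and operator norms\<close>

lemma equivalent_norm_triangle: "equivalent_norm p \<Longrightarrow> p (x + y) \<le> p x + p y"
  and equivalent_norm_scale: "equivalent_norm p \<Longrightarrow> p (c *\<^sub>R x) = \<bar>c\<bar> * p x"
  unfolding equivalent_norm_def by auto

lemma equivalent_norm_bounds:
  assumes "equivalent_norm p"
  obtains k K where "k > 0" "K > 0" "\<And>x. k * norm x \<le> p x" "\<And>x. p x \<le> K * norm x"
proof -
  obtain k K where k: "k > 0" "\<And>x. k * norm x \<le> p x" "\<And>x. p x \<le> K * norm x"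
    using assms unfolding equivalent_norm_def by blast
  have "p x \<le> max K 1 * norm x" for x
    using k(3)[of x] mult_right_mono[of K "max K 1" "norm x"] by auto
  then show thesis using k that[of k "max K 1"] by auto
qed

lemma equivalent_norm_zero_iff:
  assumes "equivalent_norm p"
  shows "p x = 0 \<longleftrightarrow> x = 0"
proof
  obtain k where k: "k > 0" "\<And>x. k * norm x \<le> p x"
    using equivalent_norm_bounds[OF assms] by metis
  assume "p x = 0"
  with k(2)[of x] have "k * norm x \<le> 0" by simp
  then show "x = 0" using k(1) by (simp add: mult_le_0_iff)
next
  assume "x = 0"
  then show "p x = 0" using equivalent_norm_scale[OF assms, of 0 x] by simp
qed

lemma equivalent_norm_nonneg:
  assumes "equivalent_norm p"
  shows "0 \<le> p x"
proof -
  obtain k where k: "k > 0" "\<And>x. k * norm x \<le> p x"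
    using equivalent_norm_bounds[OF assms] by metis
  have "0 \<le> k * norm x" using k(1) by simp
  then show ?thesis using k(2)[of x] by linarith
qed

lemma equivalent_norm_diff:
  assumes "equivalent_norm p"
  shows "p (x - y) \<le> p x + p y"
  using equivalent_norm_triangle[OF assms, of x "(-1) *\<^sub>R y"]
    equivalent_norm_scale[OF assms, of "-1" y] by simp

text \<open>
  The supremum defining the operator norm is taken in \<open>real\<close>, where an unbounded set has an
  unspecified supremum; boundedness of the operator is what gives it a meaning.
\<close>

lemma opnorm_on_bound:
  assumes p: "equivalent_norm p" and V: "subspace V"
    and scale: "\<And>c x. x \<in> V \<Longrightarrow> A (c *\<^sub>R x) = c *\<^sub>R A x"
    and bounded: "\<And>x. x \<in> V \<Longrightarrow> norm (A x) \<le> B * norm x"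
    and x: "x \<in> V"
  shows "p (A x) \<le> opnorm_on p V A * p x"
proof (cases "x = 0")
  case True
  then have "A x = 0" using scale[OF x, of 0] by simp
  then show ?thesis using True equivalent_norm_zero_iff[OF p, of 0] by simp
next
  case False
  obtain k K where k: "k > 0" "K > 0" "\<And>x. k * norm x \<le> p x" "\<And>x. p x \<le> K * norm x"
    using equivalent_norm_bounds[OF p] by metis
  have px: "p x > 0"
    using False equivalent_norm_zero_iff[OF p, of x] equivalent_norm_nonneg[OF p, of x] by linarith
  have "p (A y) \<le> K * (\<bar>B\<bar> * (1 / k))" if y: "y \<in> V" "p y \<le> 1" for y
  proof -
    have "norm y \<le> 1 / k" using k(1) k(3)[of y] y(2) by (simp add: field_simps)
    then have "\<bar>B\<bar> * norm y \<le> \<bar>B\<bar> * (1 / k)" by (intro mult_left_mono) auto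
    moreover have "norm (A y) \<le> \<bar>B\<bar> * norm y"
      using bounded[OF y(1)] mult_right_mono[OF abs_ge_self, of "norm y" B] by simp
    ultimately have "K * norm (A y) \<le> K * (\<bar>B\<bar> * (1 / k))"
      using k(2) by (intro mult_left_mono) auto
    then show ?thesis using k(4)[of "A y"] by linarith
  qed
  then have bdd: "bdd_above ((\<lambda>x. p (A x)) ` {x \<in> V. p x \<le> 1})"
    by (intro bdd_aboveI2[where M = "K * (\<bar>B\<bar> * (1 / k))"]) auto
  have "inverse (p x) *\<^sub>R x \<in> {x \<in> V. p x \<le> 1}"
    using V x px equivalent_norm_scale[OF p, of "inverse (p x)" x] by (simp add: subspace_scale)
  then have "p (A (inverse (p x) *\<^sub>R x)) \<le> opnorm_on p V A"
    unfolding opnorm_on_def by (rule cSUP_upper[OF _ bdd])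
  then have "inverse (p x) * p (A x) \<le> opnorm_on p V A"
    using scale[OF x] equivalent_norm_scale[OF p] px by simp
  then show ?thesis using px by (simp add: field_simps)
qed

section \<open>Stable and unstable spaces\<close>

lemma linear_proj_s: "linear (proj_s L)"
proof (rule linearI)
  fix x y :: 'a and r :: real
  show "proj_s L (x + y) = proj_s L x + proj_s L y"
    using blinfun.add_right[of "riesz_projection L" "(x, 0)" "(y, 0)"] by (simp add: proj_s_def)
  show "proj_s L (r *\<^sub>R x) = r *\<^sub>R proj_s L x"
    using blinfun.scaleR_right[of "riesz_projection L" r "(x, 0)"] by (simp add: proj_s_def)
qed

lemma subspace_space_s: "subspace (space_s L)"
  unfolding space_s_def by (rule linear_subspace_image[OF linear_proj_s subspace_UNIV])

lemma subspace_space_u: "subspace (space_u L)"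
proof -
  have "linear (proj_u L)"
    unfolding proj_u_def[abs_def] by (intro linear_compose_sub linear_ident linear_proj_s)
  then show ?thesis
    unfolding space_u_def by (rule linear_subspace_image[OF _ subspace_UNIV])
qed

lemma proj_s_in_space_s: "proj_s L x \<in> space_s L"
  and proj_u_in_space_u: "proj_u L x \<in> space_u L"
  by (auto simp: space_s_def space_u_def)

lemma proj_u_plus_proj_s: "proj_u L x + proj_s L x = x"
  by (simp add: proj_u_def)

section \<open>Restrictions to a subspace and their spectra\<close>

text \<open>
  A resolvent point \<open>r\<close> of the restriction of \<open>A\<close> to \<open>V\<close> forces \<open>r - A\<close> to map \<open>V\<close> into itself, and
  then so does \<open>A\<close>.
\<close>

lemma spectrum_on_invariant:
  fixes A :: "'a::real_normed_vector \<Rightarrow> 'a"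
  assumes V: "subspace V" and A: "linear A" and r: "of_real r \<notin> spectrum_on V A" and x: "x \<in> V"
  shows "A x \<in> V"
proof -
  have "bij_betw (cshift (of_real r) A) (V \<times> V) (V \<times> V)"
    using r unfolding spectrum_on_def by auto
  moreover have "(x, 0) \<in> V \<times> V" using x subspace_0[OF V] by simp
  ultimately have "cshift (of_real r) A (x, 0) \<in> V \<times> V" by (meson bij_betwE)
  then have "r *\<^sub>R x - A x \<in> V" by (simp add: cshift_def cscale_def linear_0[OF A])
  then have "r *\<^sub>R x - (r *\<^sub>R x - A x) \<in> V"
    by (rule subspace_diff[OF V subspace_scale[OF V x]])
  then show ?thesis by simp
qed

text \<open>
  Evaluating the complexified inverse at \<open>0\<close> on real vectors turns \<open>0 \<notin> \<sigma>\<close> into real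
  invertibility; the sign comes from the shift being \<open>0 - A\<close>.
\<close>

lemma zero_notin_spectrum_on:
  fixes A :: "'a::real_normed_vector \<Rightarrow> 'a"
  assumes V: "subspace V" and A: "linear A" and zero: "0 \<notin> spectrum_on V A"
  shows "inj_on A V" and "\<exists>K. \<forall>x \<in> V. norm x \<le> K * norm (A x)"
proof -
  let ?C = "cshift 0 A"
  have C: "?C (x, 0) = (- A x, 0)" for x
    by (simp add: cshift_def cscale_def linear_0[OF A])
  from zero obtain K where bij: "bij_betw ?C (V \<times> V) (V \<times> V)"
    and K: "\<And>z. z \<in> V \<times> V \<Longrightarrow> norm (inv_into (V \<times> V) ?C z) \<le> K * norm z"
    unfolding spectrum_on_def by auto
  have inj: "inj_on ?C (V \<times> V)" using bij by (rule bij_betw_imp_inj_on)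
  show "inj_on A V"
  proof (rule inj_onI)
    fix x y assume "x \<in> V" "y \<in> V" "A x = A y"
    then show "x = y"
      using subspace_0[OF V] inj_onD[OF inj, of "(x, 0)" "(y, 0)"] by (simp add: C)
  qed
  have "norm x \<le> K * norm (A x)" if x: "x \<in> V" for x
  proof -
    have x': "(x, 0) \<in> V \<times> V" using x subspace_0[OF V] by auto
    then have "?C (x, 0) \<in> V \<times> V" using bij by (meson bij_betwE)
    from K[OF this] show ?thesis
      using inv_into_f_f[OF inj x'] by (simp add: C norm_Pair)
  qed
  then show "\<exists>K. \<forall>x \<in> V. norm x \<le> K * norm (A x)" by blast
qed

section \<open>Hyperbolic operators\<close>

lemma linear_blinfun: "linear (blinfun_apply L)"
  by (rule bounded_linear.linear[OF blinfun.bounded_linear_right])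

lemma hyperbolic_operator_invariant:
  assumes "hyperbolic_operator L a b p"
  shows "x \<in> space_s L \<Longrightarrow> blinfun_apply L x \<in> space_s L"
    and "x \<in> space_u L \<Longrightarrow> blinfun_apply L x \<in> space_u L"
proof -
  \<comment> \<open>The point \<open>1\<close> lies between the two parts of the spectrum.\<close>
  have "of_real 1 \<notin> spectrum_on (space_s L) (blinfun_apply L)"
    "of_real 1 \<notin> spectrum_on (space_u L) (blinfun_apply L)"
    using assms unfolding hyperbolic_operator_def by auto
  note spectrum_on_invariant[OF subspace_space_s linear_blinfun this(1)]
    spectrum_on_invariant[OF subspace_space_u linear_blinfun this(2)]
  then show "x \<in> space_s L \<Longrightarrow> blinfun_apply L x \<in> space_s L"
    and "x \<in> space_u L \<Longrightarrow> blinfun_apply L x \<in> space_u L"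
    by simp_all
qed

lemma hyperbolic_operator_contracts:
  assumes hyp: "hyperbolic_operator L a b p" and x: "x \<in> space_s L"
  shows "p (blinfun_apply L x) \<le> b * p x"
proof -
  have p: "equivalent_norm p" and le: "opnorm_on p (space_s L) (blinfun_apply L) \<le> b"
    using hyp unfolding hyperbolic_operator_def by auto
  have "p (blinfun_apply L x) \<le> opnorm_on p (space_s L) (blinfun_apply L) * p x"
    using p subspace_space_s blinfun.scaleR_right norm_blinfun x by (rule opnorm_on_bound)
  also have "\<dots> \<le> b * p x"
    using le equivalent_norm_nonneg[OF p] by (rule mult_right_mono)
  finally show ?thesis .
qed

lemma hyperbolic_operator_expands:
  assumes hyp: "hyperbolic_operator L a b p" and x: "x \<in> space_u L"
  shows "a * p x \<le> p (blinfun_apply L x)"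
proof -
  let ?V = "space_u L" and ?L = "blinfun_apply L"
  let ?I = "inv_into ?V ?L"
  have p: "equivalent_norm p" and le: "opnorm_on p ?V ?I \<le> inverse a" and a: "a > 1"
    and zero: "0 \<notin> spectrum_on ?V ?L"
    using hyp unfolding hyperbolic_operator_def by auto
  note inv = zero_notin_spectrum_on[OF subspace_space_u linear_blinfun zero]
  from inv(2) obtain K where K: "\<And>x. x \<in> ?V \<Longrightarrow> norm x \<le> K * norm (?L x)" by blast
  \<comment> \<open>Surjectivity onto the unstable space makes \<open>inv_into\<close> a genuine inverse on all of it, as
    the operator norm of the inverse requires.\<close>
  let ?W = "?L ` ?V"
  have bij: "bij_betw (cshift 0 ?L) (?V \<times> ?V) (?V \<times> ?V)"
    using zero by (simp add: spectrum_on_def)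
  have W: "?W = ?V"
  proof
    show "?W \<subseteq> ?V" using hyperbolic_operator_invariant(2)[OF hyp] by auto
    show "?V \<subseteq> ?W"
    proof
      fix y assume "y \<in> ?V"
      then have "(- y, 0) \<in> ?V \<times> ?V"
        using subspace_neg[OF subspace_space_u] subspace_0[OF subspace_space_u] by blast
      then have "(- y, 0) \<in> cshift 0 ?L ` (?V \<times> ?V)"
        by (simp only: bij_betw_imp_surj_on[OF bij])
      then obtain u v where "u \<in> ?V" "(- y, 0) = cshift 0 ?L (u, v)" by auto
      then show "y \<in> ?W" by (auto simp: cshift_def cscale_def)
    qed
  qed
  have I: "?I (?L y) = y" if "y \<in> ?V" for y using inv_into_f_f[OF inv(1) that] .
  have "p (?I (?L x)) \<le> opnorm_on p ?V ?I * p (?L x)"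
  proof (rule opnorm_on_bound[OF p subspace_space_u])
    show "?L x \<in> ?V" using W x by auto
  next
    fix c y assume "y \<in> ?V"
    then obtain u where u: "u \<in> ?V" "y = ?L u" using W by auto
    then show "?I (c *\<^sub>R y) = c *\<^sub>R ?I y"
      using I[OF u(1)] I[OF subspace_scale[OF subspace_space_u u(1), of c]]
      by (simp add: blinfun.scaleR_right)
  next
    fix y assume "y \<in> ?V"
    then obtain u where u: "u \<in> ?V" "y = ?L u" using W by auto
    then show "norm (?I y) \<le> K * norm y" using I K by simp
  qed
  also have "\<dots> \<le> inverse a * p (?L x)"
    using le equivalent_norm_nonneg[OF p] by (rule mult_right_mono)
  finally show ?thesis using I[OF x] a by (simp add: field_simps)
qed

lemma hyperbolic_operator_norm_max:
  assumes "hyperbolic_operator L a b p"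
  shows "p x = max (p (proj_u L x)) (p (proj_s L x))"
proof -
  have "p (proj_u L x + proj_s L x) = max (p (proj_u L x)) (p (proj_s L x))"
    using assms proj_s_in_space_s proj_u_in_space_u unfolding hyperbolic_operator_def by blast
  then show ?thesis by (simp only: proj_u_plus_proj_s)
qed

text \<open>
  The maximum formula makes the sum of the two spaces direct: the two components of the zero vector
  have norm zero.
\<close>

lemma hyperbolic_operator_decomposition_unique:
  assumes hyp: "hyperbolic_operator L a b p"
    and mem: "u \<in> space_u L" "s \<in> space_s L"
  shows "proj_u L (u + s) = u" and "proj_s L (u + s) = s"
proof -
  let ?x = "u + s"
  have p: "equivalent_norm p" using hyp unfolding hyperbolic_operator_def by auto
  have "proj_u L ?x - u \<in> space_u L" "proj_s L ?x - s \<in> space_s L"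
    using subspace_diff subspace_space_u subspace_space_s mem proj_s_in_space_s proj_u_in_space_u
    by blast+
  then have "p ((proj_u L ?x - u) + (proj_s L ?x - s))
      = max (p (proj_u L ?x - u)) (p (proj_s L ?x - s))"
    using hyp unfolding hyperbolic_operator_def by blast
  moreover have "(proj_u L ?x - u) + (proj_s L ?x - s) = 0"
    using proj_u_plus_proj_s[of L ?x] by (simp add: algebra_simps)
  ultimately have "max (p (proj_u L ?x - u)) (p (proj_s L ?x - s)) = 0"
    using equivalent_norm_zero_iff[OF p, of 0] by simp
  then have "p (proj_u L ?x - u) = 0" "p (proj_s L ?x - s) = 0"
    using equivalent_norm_nonneg[OF p, of "proj_u L ?x - u"]
      equivalent_norm_nonneg[OF p, of "proj_s L ?x - s"] by linarith+
  then show "proj_u L ?x = u" "proj_s L ?x = s"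
    using equivalent_norm_zero_iff[OF p] by auto
qed

text \<open>
  One step of the perturbed linear map: the projections have norm at most one with respect to \<open>p\<close>,
  so a perturbation \<open>n\<close> costs each component at most \<open>p n\<close>.
\<close>

lemma hyperbolic_step:
  assumes hyp: "hyperbolic_operator L a b p"
  shows "p (proj_s L (blinfun_apply L w + n)) \<le> b * p (proj_s L w) + p n"
    and "a * p (proj_u L w) \<le> p (proj_u L (blinfun_apply L w + n)) + p n"
proof -
  let ?L = "blinfun_apply L"
  let ?u = "?L (proj_u L w) + proj_u L n" and ?s = "?L (proj_s L w) + proj_s L n"
  have p: "equivalent_norm p" using hyp unfolding hyperbolic_operator_def by auto
  have mem: "?u \<in> space_u L" "?s \<in> space_s L"
    by (intro subspace_add subspace_space_u subspace_space_s proj_s_in_space_s proj_u_in_space_u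
        hyperbolic_operator_invariant[OF hyp])+
  have "?u + ?s = ?L (proj_u L w + proj_s L w) + (proj_u L n + proj_s L n)"
    by (simp add: blinfun.add_right)
  then have step: "?L w + n = ?u + ?s" by (simp only: proj_u_plus_proj_s)
  have n: "p (proj_u L n) \<le> p n" "p (proj_s L n) \<le> p n"
    using hyperbolic_operator_norm_max[OF hyp, of n] by auto
  have "p ?s \<le> p (?L (proj_s L w)) + p (proj_s L n)" by (rule equivalent_norm_triangle[OF p])
  then have s: "p ?s \<le> b * p (proj_s L w) + p n"
    using hyperbolic_operator_contracts[OF hyp proj_s_in_space_s, of w] n by linarith
  have "p (?u - proj_u L n) \<le> p ?u + p (proj_u L n)" by (rule equivalent_norm_diff[OF p])
  then have u: "a * p (proj_u L w) \<le> p ?u + p n"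
    using hyperbolic_operator_expands[OF hyp proj_u_in_space_u, of w] n by simp
  show "p (proj_s L (?L w + n)) \<le> b * p (proj_s L w) + p n"
    "a * p (proj_u L w) \<le> p (proj_u L (?L w + n)) + p n"
    using s u hyperbolic_operator_decomposition_unique[OF hyp mem] by (simp_all add: step)
qed

section \<open>Bounded orbits near a weakly hyperbolic point\<close>

text \<open>
  The supremum argument: the hyperbolic rates bound the orbit by a fixed fraction of its own
  supremum.  Stable and unstable components can be treated separately because \<open>p\<close> is their maximum.
\<close>

lemma hyperbolic_bounded_orbit_zero:
  fixes w :: "int \<Rightarrow> 'a::banach"
  assumes hyp: "hyperbolic_operator L a b p"
    and gap: "0 \<le> \<gamma>" "b + \<gamma> < 1" "1 + \<gamma> < a"
    and step: "\<And>m. w (m + 1) = blinfun_apply L (w m) + n m"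
    and small: "\<And>m. p (n m) \<le> \<gamma> * p (w m)"
    and bdd: "bounded (range w)"
  shows "w m = 0"
proof -
  have p: "equivalent_norm p" and b: "0 < b" using hyp unfolding hyperbolic_operator_def by auto
  obtain K where K: "K > 0" "\<And>x. p x \<le> K * norm x"
    using equivalent_norm_bounds[OF p] by metis
  obtain B where B: "\<And>m. norm (w m) \<le> B" using bdd by (auto simp: bounded_iff)
  have "p (w m) \<le> K * B" for m
    using K(2)[of "w m"] mult_left_mono[OF B[of m], of K] K(1) by linarith
  then have bdd_p: "bdd_above (range (\<lambda>m. p (w m)))" by (intro bdd_aboveI2)
  define M where "M = (SUP m. p (w m))"
  have M: "p (w m) \<le> M" for m unfolding M_def by (rule cSUP_upper[OF UNIV_I bdd_p])
  have parts: "p (proj_u L (w m)) \<le> M" "p (proj_s L (w m)) \<le> M" for m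
    using M[of m] hyperbolic_operator_norm_max[OF hyp, of "w m"] by auto
  have n: "p (n m) \<le> \<gamma> * M" for m
    using small[of m] mult_left_mono[OF M[of m] gap(1)] by linarith
  have s: "p (proj_s L (w m)) \<le> (b + \<gamma>) * M" for m
  proof -
    \<comment> \<open>The stable part is estimated by the preceding point of the orbit.\<close>
    have "w m = blinfun_apply L (w (m - 1)) + n (m - 1)" using step[of "m - 1"] by simp
    then have "p (proj_s L (w m)) \<le> b * p (proj_s L (w (m - 1))) + p (n (m - 1))"
      using hyperbolic_step(1)[OF hyp, of "w (m - 1)" "n (m - 1)"] by simp
    also have "\<dots> \<le> b * M + \<gamma> * M"
      using parts(2) b n by (intro add_mono mult_left_mono) auto
    finally show ?thesis by (simp add: algebra_simps)
  qed
  have u: "p (proj_u L (w m)) \<le> (1 + \<gamma>) / a * M" for m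
  proof -
    have "a * p (proj_u L (w m)) \<le> p (proj_u L (w (m + 1))) + p (n m)"
      using hyperbolic_step(2)[OF hyp, of "w m" "n m"] by (simp add: step)
    also have "\<dots> \<le> (1 + \<gamma>) * M" using parts(1)[of "m + 1"] n[of m] by (simp add: algebra_simps)
    finally show ?thesis using gap by (simp add: field_simps)
  qed
  define q where "q = max (b + \<gamma>) ((1 + \<gamma>) / a)"
  have q: "q < 1" using gap by (simp add: q_def)
  have M0: "0 \<le> M" using M[of 0] equivalent_norm_nonneg[OF p, of "w 0"] by linarith
  have "p (w m) \<le> q * M" for m
  proof -
    have "(b + \<gamma>) * M \<le> q * M" "(1 + \<gamma>) / a * M \<le> q * M"
      by (rule mult_right_mono[OF _ M0], simp add: q_def)+
    then show ?thesis
      using s[of m] u[of m] hyperbolic_operator_norm_max[OF hyp, of "w m"] by linarith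
  qed
  then have "M \<le> q * M" unfolding M_def by (intro cSUP_least) auto
  then have "(1 - q) * M \<le> 0" by (simp add: algebra_simps)
  then have "M \<le> 0" using q by (simp add: mult_le_0_iff)
  then have "p (w m) = 0" using M[of m] equivalent_norm_nonneg[OF p, of "w m"] by linarith
  then show ?thesis using equivalent_norm_zero_iff[OF p] by simp
qed

lemma weakly_hyperbolic_isolated:
  fixes T :: "'a::banach \<Rightarrow> 'a"
  assumes wh: "weakly_hyperbolic L a b p N \<gamma> T x0"
  obtains U where "open U" "x0 \<in> U"
    "\<And>\<xi> :: int \<Rightarrow> 'a. global_solution T \<xi> \<Longrightarrow> range \<xi> \<subseteq> U \<Longrightarrow> \<xi> = (\<lambda>m. x0)"
proof -
  have fix0: "T x0 = x0" and TN: "\<And>x. T (x + x0) - x0 = blinfun_apply L x + N x"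
    and hyp: "hyperbolic_operator L a b p"
    and gap: "0 < \<gamma>" "b + 2 * \<gamma> < 1" "1 < a - 2 * \<gamma>"
    using wh unfolding weakly_hyperbolic_def by auto
  obtain U0 where U0: "0 \<in> interior U0"
    and lip: "\<And>x y. x \<in> U0 \<Longrightarrow> y \<in> U0 \<Longrightarrow> p (N x - N y) \<le> \<gamma> * p (x - y)"
    using wh unfolding weakly_hyperbolic_def by blast
  have N0: "N 0 = 0" using TN[of 0] fix0 by (simp add: blinfun.zero_right)
  \<comment> \<open>Intersecting with a ball keeps every orbit in the neighbourhood bounded.\<close>
  define U where "U = (+) x0 ` (interior U0 \<inter> ball 0 1)"
  have "open U" unfolding U_def by (intro open_translation) auto
  moreover have "x0 \<in> U" using U0 by (force simp: U_def)
  moreover have "\<xi> = (\<lambda>m. x0)" if sol: "global_solution T \<xi>" and sub: "range \<xi> \<subseteq> U" for \<xi> :: "int \<Rightarrow> 'a"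
  proof
    fix m
    define w where "w = (\<lambda>m. \<xi> m - x0)"
    have w: "w m \<in> interior U0" "norm (w m) < 1" for m
    proof -
      have "\<xi> m \<in> U" using sub by auto
      then show "w m \<in> interior U0" "norm (w m) < 1" by (auto simp: U_def w_def)
    qed
    have "w m = 0"
    proof (rule hyperbolic_bounded_orbit_zero[OF hyp, where \<gamma> = \<gamma> and n = "\<lambda>m. N (w m)"])
      show "w (m + 1) = blinfun_apply L (w m) + N (w m)" for m
        using TN[of "w m"] sol by (simp add: w_def global_solution_def)
      show "p (N (w m)) \<le> \<gamma> * p (w m)" for m
        using lip[of "w m" 0] w(1)[of m] U0 interior_subset[of U0] N0 by auto
      show "bounded (range w)"
        unfolding bounded_iff using w(2) by (intro exI[of _ 1]) (auto intro: less_imp_le)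
    qed (use gap in auto)
    then show "\<xi> m = x0" by (simp add: w_def)
  qed
  ultimately show thesis using that by blast
qed

theorem theorem3p9:
  fixes T :: "'a::banach \<Rightarrow> 'a" and x0 :: 'a
  assumes "continuous_on UNIV T"
    and "L_hyperbolic T x0"
  shows "\<exists>U. open U \<and> x0 \<in> U \<and>
           (\<forall>\<xi> :: int \<Rightarrow> 'a. global_solution T \<xi> \<and> range \<xi> \<subseteq> U \<longleftrightarrow> \<xi> = (\<lambda>m. x0))"
proof -
  obtain L a b p N \<gamma> where wh: "weakly_hyperbolic L a b p N \<gamma> T x0"
    using assms(2) unfolding L_hyperbolic_def by blast
  obtain U where U: "open U" "x0 \<in> U"
    "\<And>\<xi> :: int \<Rightarrow> 'a. global_solution T \<xi> \<Longrightarrow> range \<xi> \<subseteq> U \<Longrightarrow> \<xi> = (\<lambda>m. x0)"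
    using weakly_hyperbolic_isolated[OF wh] by blast
  have "T x0 = x0" using wh unfolding weakly_hyperbolic_def by blast
  then have const: "global_solution T (\<lambda>m. x0)" by (simp add: global_solution_def)
  have "global_solution T \<xi> \<and> range \<xi> \<subseteq> U \<longleftrightarrow> \<xi> = (\<lambda>m. x0)" for \<xi> :: "int \<Rightarrow> 'a"
  proof
    assume "global_solution T \<xi> \<and> range \<xi> \<subseteq> U"
    then show "\<xi> = (\<lambda>m. x0)" by (intro U(3)) simp_all
  next
    assume \<xi>: "\<xi> = (\<lambda>m. x0)"
    show "global_solution T \<xi> \<and> range \<xi> \<subseteq> U"
      unfolding \<xi> using const U(2) by (simp add: image_subset_iff)
  qed
  with U(1,2) show ?thesis by blast
qed

end
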